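(* Let $N\ge2$ and $I=\{1,\ldots,N\}$. The SDSE associated to the formal series $$F_1=1+h_2,\quad F_2=1+h_3,\quad\ldots,\quad F_{N-1}=1+h_N,\quad F_N=1+h_1$$ is Hopf.
   Context: $K$ is a field of characteristic zero and $I$ a finite non-empty set. $\mathcal{H}_I$ is the (Connes-Kreimer) polynomial algebra generated by the set of (isomorphism classes of non-planar) rooted trees whose vertices are decorated by elements of $I$; monomials are forests; it is graded by the number of vertices, and $\widehat{\mathcal H_I}=\prod_n\mathcal H_I(n)$ is its completion. The coproduct is the algebra morphism with $\Delta(t)=t\otimes1+1\otimes t+\sum_cP^c(t)\otimes R^c(t)$ for each tree $t$, where $c$ runs over non-empty sets of edges of $t$ such that every path from the root to a leaf meets at most one edge of $c$; after deleting the edges of $c$, $R^c(t)$ is the component containing the root and $P^c(t)$ is the product of the other components. This makes $\mathcal H_I$ a Hopf algebra. $B_i^+$ is the linear (continuous) operator sending a forest to the tree obtained by grafting its trees on a common root decorated by $i$. The SDSE $(S)$ associated to non-constant series $(F_i)_{i\in I}$, $F_i\in K[[h_j,j\in I]]$, is the system $X_i=B_i^+(F_i(X_j,j\in I))$, $i\in I$; it has a unique solution $(X_i)_{i\in I}\in\widehat{\mathcal H_I}^{\,I}$. $X_i(n)$ is the homogeneous component of degree $n$ of $X_i$, and $\mathcal H_{(S)}$ is the subalgebra of $\mathcal H_I$ generated by all the $X_i(n)$. $(S)$ is Hopf if $\mathcal H_{(S)}$ is a Hopf subalgebra of $\mathcal H_I$. *)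

theory Defs
  imports
    "HOL-Library.Multiset"
    "HOL-Library.Poly_Mapping"
    "HOL-Library.Product_Plus"
    "HOL-Library.Sublist"
    "HOL-Computational_Algebra.Formal_Power_Series"
begin

section \<open>Finitely supported functions as free vector spaces\<close>

definition pm_scale :: "'k::field \<Rightarrow> ('a \<Rightarrow>\<^sub>0 'k) \<Rightarrow> ('a \<Rightarrow>\<^sub>0 'k)" where
  "pm_scale c x = Poly_Mapping.map ((*) c) x"

lemma lookup_pm_scale [simp]:
  "Poly_Mapping.lookup (pm_scale c x) a = c * Poly_Mapping.lookup x a"
  by (simp add: pm_scale_def Poly_Mapping.map.rep_eq when_def)

interpretation pm: vector_space "pm_scale :: 'k::field \<Rightarrow> ('a \<Rightarrow>\<^sub>0 'k) \<Rightarrow> ('a \<Rightarrow>\<^sub>0 'k)"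
  by unfold_locales (auto intro!: poly_mapping_eqI simp: lookup_add algebra_simps)

text \<open>The linear map that is given by \<open>\<phi>\<close> on the basis.\<close>

definition lin_ext :: "('a \<Rightarrow> ('b \<Rightarrow>\<^sub>0 'k::field)) \<Rightarrow> ('a \<Rightarrow>\<^sub>0 'k) \<Rightarrow> ('b \<Rightarrow>\<^sub>0 'k)" where
  "lin_ext \<phi> x = (\<Sum>a\<in>Poly_Mapping.keys x. pm_scale (Poly_Mapping.lookup x a) (\<phi> a))"


section \<open>Decorated rooted trees and the algebra of forests\<close>

text \<open>
  As the children of a vertex form a multiset, the elements of \<open>'i dtree\<close> are exactly the
  isomorphism classes of non-planar rooted trees with vertices decorated by \<open>'i\<close>.
  A forest is a monomial in the trees; as monomials are written additively in
  \<^type>\<open>poly_mapping\<close>, the ring \<open>('i, 'k) ck\<close> is the polynomial algebra over \<open>'k\<close>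
  generated by the trees, with the empty forest \<open>{#}\<close> as unit monomial.
\<close>

datatype (decs: 'i) dtree = Node 'i "'i dtree multiset"

type_synonym 'i forest = "'i dtree multiset"

type_synonym ('i, 'k) ck = "'i forest \<Rightarrow>\<^sub>0 'k"

primrec num_vertices :: "'i dtree \<Rightarrow> nat" where
  "num_vertices (Node i f) = Suc (sum_mset (image_mset num_vertices f))"

definition forest_degree :: "'i forest \<Rightarrow> nat" where
  "forest_degree f = (\<Sum>t\<in>#f. num_vertices t)"

definition forest_decs :: "'i forest \<Rightarrow> 'i set" where
  "forest_decs f = (\<Union>t\<in>set_mset f. decs t)"

definition CK :: "'i set \<Rightarrow> ('i, 'k::field) ck set" where
  "CK I = {x. \<forall>f\<in>Poly_Mapping.keys x. forest_decs f \<subseteq> I}"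

definition CK_homogeneous :: "'i set \<Rightarrow> nat \<Rightarrow> ('i, 'k::field) ck set" where
  "CK_homogeneous I n = {x \<in> CK I. \<forall>f\<in>Poly_Mapping.keys x. forest_degree f = n}"

definition Bplus :: "'i \<Rightarrow> ('i, 'k::field) ck \<Rightarrow> ('i, 'k) ck" where
  "Bplus i = lin_ext (\<lambda>f. Poly_Mapping.single {#Node i f#} 1)"


section \<open>Admissible cuts\<close>

text \<open>
  To speak about sets of edges of a tree, a planar representative of it is chosen.  Vertices of
  a planar tree are addressed by positions: the root is \<open>[]\<close>, and the child with index
  \<open>k\<close> of the vertex \<open>p\<close> is \<open>p @ [k]\<close>.  An edge is identified with its endpoint farther from
  the root, so edges are the nonempty positions, and the edges on the path from the root
  to \<open>l\<close> are the nonempty prefixes of \<open>l\<close>.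
\<close>

datatype 'i ptree = PNode 'i "'i ptree list"

primrec forget_planar :: "'i ptree \<Rightarrow> 'i dtree" where
  "forget_planar (PNode i ts) = Node i (mset (map forget_planar ts))"

lemma forget_planar_surj: "\<exists>p. forget_planar p = t"
proof (induction t)
  case (Node i f)
  obtain ts where ts: "mset ts = f"
    using ex_mset by blast
  have "\<forall>t\<in>set ts. \<exists>p. forget_planar p = t"
    using Node ts by (metis set_mset_mset)
  then obtain g where "\<forall>t\<in>set ts. forget_planar (g t) = t"
    by metis
  then have "forget_planar (PNode i (map g ts)) = Node i f"
    using ts by (simp add: comp_def map_idI)
  then show ?case ..
qed

fun subtree_at :: "'i ptree \<Rightarrow> nat list \<Rightarrow> 'i ptree option" where
  "subtree_at t [] = Some t"
| "subtree_at (PNode i ts) (k # p) = (if k < length ts then subtree_at (ts ! k) p else None)"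

definition positions :: "'i ptree \<Rightarrow> nat list set" where
  "positions t = {p. subtree_at t p \<noteq> None}"

definition edges :: "'i ptree \<Rightarrow> nat list set" where
  "edges t = positions t - {[]}"

definition leaves :: "'i ptree \<Rightarrow> nat list set" where
  "leaves t = {p \<in> positions t. \<forall>k. p @ [k] \<notin> positions t}"

definition admissible_cut :: "'i ptree \<Rightarrow> nat list set \<Rightarrow> bool" where
  "admissible_cut t c \<longleftrightarrow>
     c \<noteq> {} \<and> c \<subseteq> edges t \<and> (\<forall>l\<in>leaves t. card {e \<in> c. prefix e l} \<le> 1)"

lemma finite_positions: "finite (positions t)"
proof (induction t)
  case (PNode i ts)
  have "positions (PNode i ts) \<subseteq>
        insert [] (\<Union>k\<in>{..<length ts}. (#) k ` positions (ts ! k))"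
  proof
    fix p assume "p \<in> positions (PNode i ts)"
    then show "p \<in> insert [] (\<Union>k\<in>{..<length ts}. (#) k ` positions (ts ! k))"
      by (cases p) (auto simp: positions_def split: if_splits)
  qed
  moreover have "finite (positions (ts ! k))" if "k < length ts" for k
    using PNode that by simp
  ultimately show ?case
    by (auto intro: finite_subset)
qed

lemma finite_admissible_cuts: "finite {c. admissible_cut t c}"
proof (rule finite_subset)
  show "{c. admissible_cut t c} \<subseteq> Pow (positions t)"
    by (auto simp: admissible_cut_def edges_def)
qed (simp add: finite_positions)

text \<open>
  If \<open>t\<close> is the subtree at position \<open>p\<close> of a larger tree, then \<open>component c p t\<close> is the part of
  \<open>t\<close> that remains connected to \<open>p\<close> after the edges in \<open>c\<close> have been deleted.
\<close>

function component :: "nat list set \<Rightarrow> nat list \<Rightarrow> 'i ptree \<Rightarrow> 'i dtree" where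
  "component c p (PNode i ts) =
     Node i (mset (map (\<lambda>k. component c (p @ [k]) (ts ! k))
                       (filter (\<lambda>k. p @ [k] \<notin> c) [0..<length ts])))"
  by pat_completeness auto
termination
  by (relation "Wellfounded.measure (\<lambda>(c, p, t). size t)")
     (auto simp: less_Suc_eq_le intro!: size_list_estimation' nth_mem)

definition cut_R :: "nat list set \<Rightarrow> 'i ptree \<Rightarrow> 'i dtree" where
  "cut_R c t = component c [] t"

definition cut_P :: "nat list set \<Rightarrow> 'i ptree \<Rightarrow> 'i forest" where
  "cut_P c t = image_mset (\<lambda>p. component c p (the (subtree_at t p))) (mset_set c)"


section \<open>The Hopf algebra structure\<close>

text \<open>
  \<open>('i, 'k) ck2\<close> is the tensor square of \<open>('i, 'k) ck\<close>: the pair \<open>(f, g)\<close> is the basis element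
  \<open>f \<otimes> g\<close>, and the product is the one of the tensor product of algebras.
\<close>

type_synonym ('i, 'k) ck2 = "('i forest \<times> 'i forest) \<Rightarrow>\<^sub>0 'k"

definition tensor :: "('i, 'k::field) ck \<Rightarrow> ('i, 'k) ck \<Rightarrow> ('i, 'k) ck2" where
  "tensor x y = lin_ext (\<lambda>f. lin_ext (\<lambda>g. Poly_Mapping.single (f, g) 1) y) x"

definition tensor_square :: "('i, 'k::field) ck set \<Rightarrow> ('i, 'k) ck2 set" where
  "tensor_square A = pm.span {tensor a b | a b. a \<in> A \<and> b \<in> A}"

text \<open>
  The sum below does not depend on the choice of the planar representative: reordering children
  transports admissible cuts, and \<open>cut_P\<close> and \<open>cut_R\<close> take non-planar values.
\<close>

definition coproduct_tree :: "'i dtree \<Rightarrow> ('i, 'k::field) ck2" where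
  "coproduct_tree t =
     Poly_Mapping.single ({#t#}, {#}) 1 + Poly_Mapping.single ({#}, {#t#}) 1 +
     (let p = (SOME p. forget_planar p = t)
      in \<Sum>c | admissible_cut p c. Poly_Mapping.single (cut_P c p, {#cut_R c p#}) 1)"

definition coproduct :: "('i, 'k::field) ck \<Rightarrow> ('i, 'k) ck2" where
  "coproduct = lin_ext (\<lambda>f. \<Prod>t\<in>#f. coproduct_tree t)"

definition counit :: "('i, 'k::field) ck \<Rightarrow> 'k" where
  "counit x = Poly_Mapping.lookup x {#}"

definition convolution ::
  "(('i, 'k::field) ck \<Rightarrow> ('i, 'k) ck) \<Rightarrow> (('i, 'k) ck \<Rightarrow> ('i, 'k) ck) \<Rightarrow> ('i, 'k) ck \<Rightarrow> ('i, 'k) ck"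
  where
  "convolution \<phi> \<psi> x =
     lin_ext (\<lambda>(f, g). \<phi> (Poly_Mapping.single f 1) * \<psi> (Poly_Mapping.single g 1)) (coproduct x)"

text \<open>
  Only the restriction of \<open>S\<close> to \<^term>\<open>CK I\<close> matters; convolution inverses being unique, that
  restriction is the antipode of the Hopf algebra \<^term>\<open>CK I\<close>.
\<close>

definition is_antipode :: "'i set \<Rightarrow> (('i, 'k::field) ck \<Rightarrow> ('i, 'k) ck) \<Rightarrow> bool" where
  "is_antipode I S \<longleftrightarrow>
     Vector_Spaces.linear pm_scale pm_scale S \<and> S ` CK I \<subseteq> CK I \<and>
     (\<forall>x\<in>CK I. convolution S id x = pm_scale (counit x) 1 \<and>
                convolution id S x = pm_scale (counit x) 1)"

definition subalgebra :: "('i, 'k::field) ck set \<Rightarrow> bool" where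
  "subalgebra A \<longleftrightarrow>
     1 \<in> A \<and> (\<forall>x\<in>A. \<forall>y\<in>A. x + y \<in> A \<and> x * y \<in> A) \<and> (\<forall>c. \<forall>x\<in>A. pm_scale c x \<in> A)"

definition Hopf_subalgebra :: "'i set \<Rightarrow> ('i, 'k::field) ck set \<Rightarrow> bool" where
  "Hopf_subalgebra I A \<longleftrightarrow>
     A \<subseteq> CK I \<and> subalgebra A \<and>
     (\<forall>x\<in>A. coproduct x \<in> tensor_square A) \<and>
     (\<forall>S. is_antipode I S \<longrightarrow> S ` A \<subseteq> A)"


section \<open>Systems of Dyson--Schwinger equations\<close>

text \<open>
  The completion, i.e. the product of the homogeneous components, is realised inside the ring of
  formal power series over \<open>('i, 'k) ck\<close>: the coefficient \<open>fps_nth x n\<close> is the homogeneous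
  component of degree \<open>n\<close> of \<open>x\<close>, and the Cauchy product is the product of the completion.
\<close>

definition CK_completion :: "'i set \<Rightarrow> ('i, 'k::field) ck fps set" where
  "CK_completion I = {x. \<forall>n. fps_nth x n \<in> CK_homogeneous I n}"

text \<open>
  The continuous extension of \<^const>\<open>Bplus\<close>, which raises the degree by one.
\<close>

definition Bplus_hat :: "'i \<Rightarrow> ('i, 'k::field) ck fps \<Rightarrow> ('i, 'k) ck fps" where
  "Bplus_hat i x = fps_X * Abs_fps (\<lambda>n. Bplus i (fps_nth x n))"

text \<open>
  A multivariate formal power series in variables \<open>hvar j\<close> is given by its coefficients, where the
  multiset \<open>m\<close> stands for the monomial \<open>\<Prod>j\<in>#m. hvar j\<close>; polynomials in the \<open>hvar j\<close> are
  elements of \<open>'i multiset \<Rightarrow>\<^sub>0 'k\<close>, and \<^const>\<open>Poly_Mapping.lookup\<close> turns them into series.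
\<close>

type_synonym ('i, 'k) mps = "'i multiset \<Rightarrow> 'k"

definition hvar :: "'i \<Rightarrow> ('i multiset \<Rightarrow>\<^sub>0 'k::field)" where
  "hvar j = Poly_Mapping.single {#j#} 1"

text \<open>
  Substitution of series \<open>X j\<close> without constant term: by \<open>mset_prod_nth_eq_0\<close> below, only monomials
  of total degree at most \<open>n\<close> contribute to the component of degree \<open>n\<close>.
\<close>

definition mps_subst ::
  "'i set \<Rightarrow> ('i, 'k::field) mps \<Rightarrow> ('i \<Rightarrow> ('i, 'k) ck fps) \<Rightarrow> ('i, 'k) ck fps" where
  "mps_subst I G X =
     Abs_fps (\<lambda>n. \<Sum>m | set_mset m \<subseteq> I \<and> size m \<le> n.
                     pm_scale (G m) (fps_nth (\<Prod>j\<in>#m. X j) n))"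

definition SDSE :: "'i set \<Rightarrow> ('i \<Rightarrow> ('i, 'k::field) mps) \<Rightarrow> bool" where
  "SDSE I F \<longleftrightarrow>
     finite I \<and> I \<noteq> {} \<and>
     (\<forall>i\<in>I. (\<forall>m. F i m \<noteq> 0 \<longrightarrow> set_mset m \<subseteq> I) \<and> (\<exists>m. m \<noteq> {#} \<and> F i m \<noteq> 0))"

text \<open>The last condition only makes the family \<open>X\<close>, indexed by \<open>I\<close>, a unique total function.\<close>

definition is_SDSE_solution ::
  "'i set \<Rightarrow> ('i \<Rightarrow> ('i, 'k::field) mps) \<Rightarrow> ('i \<Rightarrow> ('i, 'k) ck fps) \<Rightarrow> bool" where
  "is_SDSE_solution I F X \<longleftrightarrow>
     (\<forall>i\<in>I. X i \<in> CK_completion I \<and> X i = Bplus_hat i (mps_subst I (F i) X)) \<and>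
     (\<forall>i. i \<notin> I \<longrightarrow> X i = 0)"

definition SDSE_solution ::
  "'i set \<Rightarrow> ('i \<Rightarrow> ('i, 'k::field) mps) \<Rightarrow> 'i \<Rightarrow> ('i, 'k) ck fps" where
  "SDSE_solution I F = (THE X. is_SDSE_solution I F X)"

definition SDSE_subalgebra :: "'i set \<Rightarrow> ('i \<Rightarrow> ('i, 'k::field) mps) \<Rightarrow> ('i, 'k) ck set" where
  "SDSE_subalgebra I F = subalgebra hull {fps_nth (SDSE_solution I F i) n | i n. i \<in> I}"

definition Hopf_SDSE :: "'i set \<Rightarrow> ('i \<Rightarrow> ('i, 'k::field) mps) \<Rightarrow> bool" where
  "Hopf_SDSE I F \<longleftrightarrow> SDSE I F \<and> Hopf_subalgebra I (SDSE_subalgebra I F)"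


section \<open>Existence and uniqueness of the solution\<close>

lemma mset_prod_nth_eq_0:
  fixes X :: "'i \<Rightarrow> 'a::comm_ring_1 fps"
  assumes "\<And>j. j \<in># m \<Longrightarrow> fps_nth (X j) 0 = 0" "n < size m"
  shows "fps_nth (\<Prod>j\<in>#m. X j) n = 0"
  using assms
proof (induction m arbitrary: n)
  case (add j m)
  have "fps_nth (X j) k * fps_nth (\<Prod>j\<in>#m. X j) (n - k) = 0" if "k \<le> n" for k
  proof (cases "k = 0")
    case False
    then have "n - k < size m" using that add.prems(2) by simp
    then show ?thesis using add by simp
  qed (use add.prems in simp)
  then show ?case by (simp add: fps_mult_nth)
qed simp

lemma finite_monomials:
  assumes "finite I"
  shows "finite {m. set_mset m \<subseteq> I \<and> size m \<le> n}"
proof (rule finite_subset)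
  show "{m. set_mset m \<subseteq> I \<and> size m \<le> n} \<subseteq> mset ` {xs. set xs \<subseteq> I \<and> length xs \<le> n}"
  proof
    fix m assume "m \<in> {m. set_mset m \<subseteq> I \<and> size m \<le> n}"
    moreover obtain xs where "mset xs = m"
      using ex_mset by blast
    ultimately show "m \<in> mset ` {xs. set xs \<subseteq> I \<and> length xs \<le> n}"
      by auto
  qed
qed (use finite_lists_length_le[OF assms] in simp)

lemma mset_prod_nth_cong:
  fixes X Y :: "'i \<Rightarrow> 'a::comm_ring_1 fps"
  assumes "\<And>j k. j \<in># m \<Longrightarrow> k \<le> n \<Longrightarrow> fps_nth (X j) k = fps_nth (Y j) k"
  shows "fps_nth (\<Prod>j\<in>#m. X j) n = fps_nth (\<Prod>j\<in>#m. Y j) n"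
  using assms
proof (induction m arbitrary: n)
  case (add j m)
  have "fps_nth (X j) k * fps_nth (\<Prod>j\<in>#m. X j) (n - k) =
        fps_nth (Y j) k * fps_nth (\<Prod>j\<in>#m. Y j) (n - k)" if "k \<le> n" for k
    using add that by simp
  then show ?case by (simp add: fps_mult_nth)
qed simp

lemma mps_subst_nth_cong:
  assumes "\<And>j k. j \<in> I \<Longrightarrow> k \<le> n \<Longrightarrow> fps_nth (X j) k = fps_nth (Y j) k"
  shows "fps_nth (mps_subst I G X) n = fps_nth (mps_subst I G Y) n"
  unfolding mps_subst_def fps_nth_Abs_fps
  by (intro sum.cong refl arg_cong2[of _ _ _ _ pm_scale] mset_prod_nth_cong) (use assms in auto)

lemma Bplus_hat_nth:
  "fps_nth (Bplus_hat i x) n = (case n of 0 \<Rightarrow> 0 | Suc k \<Rightarrow> Bplus i (fps_nth x k))"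
  by (cases n) (auto simp: Bplus_hat_def)

lemma CK_homogeneous_0: "0 \<in> CK_homogeneous I n"
  by (simp add: CK_homogeneous_def CK_def)

lemma CK_homogeneous_add:
  "x \<in> CK_homogeneous I n \<Longrightarrow> y \<in> CK_homogeneous I n \<Longrightarrow> x + y \<in> CK_homogeneous I n"
  using keys_add[of x y] unfolding CK_homogeneous_def CK_def by blast

lemma CK_homogeneous_scale: "x \<in> CK_homogeneous I n \<Longrightarrow> pm_scale c x \<in> CK_homogeneous I n"
  unfolding CK_homogeneous_def CK_def by (auto simp: in_keys_iff)

lemma CK_homogeneous_sum:
  "(\<And>a. a \<in> A \<Longrightarrow> g a \<in> CK_homogeneous I n) \<Longrightarrow> sum g A \<in> CK_homogeneous I n"
  by (induction A rule: infinite_finite_induct) (auto intro: CK_homogeneous_0 CK_homogeneous_add)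

lemma CK_homogeneous_mult:
  assumes "x \<in> CK_homogeneous I a" "y \<in> CK_homogeneous I b"
  shows "x * y \<in> CK_homogeneous I (a + b)"
proof -
  have "forest_decs f \<subseteq> I \<and> forest_degree f = a + b"
    if f: "f \<in> Poly_Mapping.keys (x * y)" for f
  proof -
    obtain u v where "f = u + v" "u \<in> Poly_Mapping.keys x" "v \<in> Poly_Mapping.keys y"
      using subsetD[OF keys_mult f] by auto
    then show ?thesis
      using assms by (auto simp: CK_homogeneous_def CK_def forest_decs_def forest_degree_def)
  qed
  then show ?thesis by (auto simp: CK_homogeneous_def CK_def)
qed

lemma CK_homogeneous_Bplus:
  assumes "x \<in> CK_homogeneous I n" "i \<in> I"
  shows "Bplus i x \<in> CK_homogeneous I (Suc n)"
  unfolding Bplus_def lin_ext_def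
  by (intro CK_homogeneous_sum CK_homogeneous_scale)
     (use assms in \<open>auto simp: CK_homogeneous_def CK_def forest_decs_def forest_degree_def\<close>)

lemma CK_homogeneous_mset_prod:
  assumes "\<And>j k. j \<in># m \<Longrightarrow> k \<le> n \<Longrightarrow> fps_nth (X j) k \<in> CK_homogeneous I k"
  shows "fps_nth (\<Prod>j\<in>#m. X j) n \<in> CK_homogeneous I n"
  using assms
proof (induction m arbitrary: n)
  case empty
  show ?case
    by (cases n) (auto simp: CK_homogeneous_0 CK_homogeneous_def CK_def forest_decs_def
        forest_degree_def)
next
  case (add j m)
  have "fps_nth (X j) k * fps_nth (\<Prod>j\<in>#m. X j) (n - k) \<in> CK_homogeneous I n" if "k \<le> n" for k
    using CK_homogeneous_mult[of "fps_nth (X j) k" I k "fps_nth (\<Prod>j\<in>#m. X j) (n - k)" "n - k"]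
      add that by simp
  then show ?case by (auto simp: fps_mult_nth intro!: CK_homogeneous_sum)
qed

lemma CK_homogeneous_mps_subst:
  assumes "\<And>j k. j \<in> I \<Longrightarrow> k \<le> n \<Longrightarrow> fps_nth (X j) k \<in> CK_homogeneous I k"
  shows "fps_nth (mps_subst I G X) n \<in> CK_homogeneous I n"
  unfolding mps_subst_def fps_nth_Abs_fps
  by (intro CK_homogeneous_sum CK_homogeneous_scale CK_homogeneous_mset_prod) (use assms in auto)

function solution_coeff ::
  "'i set \<Rightarrow> ('i \<Rightarrow> ('i, 'k::field) mps) \<Rightarrow> nat \<Rightarrow> 'i \<Rightarrow> ('i, 'k) ck" where
  "solution_coeff I F 0 i = 0"
| "solution_coeff I F (Suc n) i =
     (if i \<in> I
      then Bplus i (fps_nth (mps_subst I (F i)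
             (\<lambda>j. Abs_fps (\<lambda>k. if k \<le> n then solution_coeff I F k j else 0))) n)
      else 0)"
  by pat_completeness auto
termination
  by (relation "Wellfounded.measure (\<lambda>(I, F, n, i). n)") auto

theorem SDSE_solution_ex1: "\<exists>!X. is_SDSE_solution I F X"
proof (rule ex1I)
  define X where "X = (\<lambda>i. Abs_fps (\<lambda>n. solution_coeff I F n i))"
  have out: "X i = 0" if "i \<notin> I" for i
    unfolding X_def
  proof (rule fps_ext)
    show "fps_nth (Abs_fps (\<lambda>n. solution_coeff I F n i)) n = fps_nth 0 n" for n
      using that by (cases n) auto
  qed
  have eq: "X i = Bplus_hat i (mps_subst I (F i) X)" if "i \<in> I" for i
  proof (rule fps_ext)
    show "fps_nth (X i) n = fps_nth (Bplus_hat i (mps_subst I (F i) X)) n" for n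
    proof (cases n)
      case (Suc k)
      have "fps_nth (mps_subst I (F i)
              (\<lambda>j. Abs_fps (\<lambda>l. if l \<le> k then solution_coeff I F l j else 0))) k =
            fps_nth (mps_subst I (F i) X) k"
        by (rule mps_subst_nth_cong) (simp add: X_def)
      then show ?thesis
        using Suc that by (simp add: X_def Bplus_hat_nth)
    qed (simp add: X_def Bplus_hat_nth)
  qed
  have hom: "\<forall>i\<in>I. fps_nth (X i) n \<in> CK_homogeneous I n" for n
  proof (induction n rule: less_induct)
    case (less n)
    show ?case
    proof
      fix i assume i: "i \<in> I"
      show "fps_nth (X i) n \<in> CK_homogeneous I n"
      proof (cases n)
        case 0
        then show ?thesis by (simp add: X_def CK_homogeneous_0)
      next
        case (Suc k)
        have "fps_nth (X i) n = Bplus i (fps_nth (mps_subst I (F i) X) k)"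
          by (subst eq[OF i]) (simp add: Suc Bplus_hat_nth)
        also have "\<dots> \<in> CK_homogeneous I (Suc k)"
          by (intro CK_homogeneous_Bplus CK_homogeneous_mps_subst i) (use less Suc in auto)
        finally show ?thesis using Suc by simp
      qed
    qed
  qed
  show "is_SDSE_solution I F X"
    using out eq hom by (auto simp: is_SDSE_solution_def CK_completion_def)
  show "Y = X" if Y: "is_SDSE_solution I F Y" for Y
  proof
    have eqY: "Y i = Bplus_hat i (mps_subst I (F i) Y)" if "i \<in> I" for i
      using Y that by (auto simp: is_SDSE_solution_def)
    have *: "\<forall>i\<in>I. fps_nth (Y i) n = fps_nth (X i) n" for n
    proof (induction n rule: less_induct)
      case (less n)
      show ?case
      proof
        fix i assume i: "i \<in> I"
        have "fps_nth (Bplus_hat i (mps_subst I (F i) Y)) n =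
              fps_nth (Bplus_hat i (mps_subst I (F i) X)) n"
          using less by (cases n) (auto simp: Bplus_hat_nth intro!: arg_cong[of _ _ "Bplus i"]
              mps_subst_nth_cong)
        then show "fps_nth (Y i) n = fps_nth (X i) n"
          using eqY[OF i] eq[OF i] by simp
      qed
    qed
    show "Y i = X i" for i
      by (cases "i \<in> I") (use * Y out in \<open>auto simp: is_SDSE_solution_def intro: fps_ext\<close>)
  qed
qed

end

theory Submission
  imports Defs
begin

text \<open>
  The component \<open>X_i(n)\<close> is a single ladder with \<open>n\<close> vertices, decorated by
  \<open>i, i + 1, i + 2, \<dots>\<close> cyclically from the root to the leaf. Hence the subalgebra is spanned by the
  forests of such ladders. Cutting an edge of a ladder leaves two ladders of the same kind, so
  this span is stable under the coproduct. The antipode satisfies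
  \<open>S(f) = - (\<Sum> S(f') f'')\<close>, where \<open>f'\<close> has smaller degree than the non-empty forest \<open>f\<close>, so it is
  stable under \<open>S\<close> by induction on the degree.
\<close>

section \<open>Linear extension and supports\<close>

text \<open>Basis elements outside the support contribute zero. A larger index set lets the sums for
  two vectors be compared over one common set.\<close>

lemma lin_ext_superset:
  assumes "finite A" "Poly_Mapping.keys x \<subseteq> A"
  shows "lin_ext \<phi> x = (\<Sum>a\<in>A. pm_scale (Poly_Mapping.lookup x a) (\<phi> a))"
  unfolding lin_ext_def
  by (rule sum.mono_neutral_left) (use assms in \<open>auto simp: in_keys_iff\<close>)

lemma lin_ext_add: "lin_ext \<phi> (x + y) = lin_ext \<phi> x + lin_ext \<phi> y"
proof -
  let ?A = "Poly_Mapping.keys x \<union> Poly_Mapping.keys y"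
  have "finite ?A" "Poly_Mapping.keys (x + y) \<subseteq> ?A"
    by (auto simp: keys_add)
  then show ?thesis
    by (simp add: lin_ext_superset[of ?A] lookup_add pm.scale_left_distrib sum.distrib)
qed

lemma lin_ext_single: "lin_ext \<phi> (Poly_Mapping.single a 1) = \<phi> a"
  by (simp add: lin_ext_def)

text \<open>Expanding a vector in the basis reduces membership in a subspace to membership of basis
  elements.\<close>

lemma lin_ext_unit: "lin_ext (\<lambda>a. Poly_Mapping.single a 1) x = x"
  by (rule poly_mapping_eqI)
     (auto simp: lin_ext_def lookup_sum lookup_single when_def in_keys_iff sum.delta if_distrib
       cong: if_cong)

lemma lin_ext_mem:
  assumes "pm.subspace V" "\<And>a. a \<in> Poly_Mapping.keys x \<Longrightarrow> \<phi> a \<in> V"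
  shows "lin_ext \<phi> x \<in> V"
  unfolding lin_ext_def
  by (intro pm.subspace_sum pm.subspace_scale assms)

text \<open>This is the span of the basis elements indexed by \<open>M\<close>. Phrased with keys,
  closure under products reduces to closure of \<open>M\<close> under addition of monomials.\<close>

definition supported_on :: "'a set \<Rightarrow> ('a \<Rightarrow>\<^sub>0 'k::field) set" where
  "supported_on M = {x. Poly_Mapping.keys x \<subseteq> M}"

lemma supported_on_subspace: "pm.subspace (supported_on M)"
proof (rule pm.subspaceI)
  show "x + y \<in> supported_on M" if "x \<in> supported_on M" "y \<in> supported_on M" for x y
    using that keys_add[of x y] unfolding supported_on_def by blast
qed (auto simp: supported_on_def in_keys_iff)

lemma supported_on_single: "a \<in> M \<Longrightarrow> Poly_Mapping.single a c \<in> supported_on M"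
  by (simp add: supported_on_def)

lemma supported_on_mult:
  assumes "x \<in> supported_on M" "y \<in> supported_on M'" "\<And>a b. a \<in> M \<Longrightarrow> b \<in> M' \<Longrightarrow> a + b \<in> M''"
  shows "x * y \<in> supported_on M''"
  using assms keys_mult[of x y] unfolding supported_on_def by blast

lemma supported_on_mono: "x \<in> supported_on M \<Longrightarrow> M \<subseteq> M' \<Longrightarrow> x \<in> supported_on M'"
  by (auto simp: supported_on_def)

lemma supported_on_subset_subspace:
  fixes V :: "('a \<Rightarrow>\<^sub>0 'k::field) set"
  assumes "pm.subspace V" "\<And>a. a \<in> M \<Longrightarrow> Poly_Mapping.single a 1 \<in> V"
  shows "supported_on M \<subseteq> V"
proof
  fix x :: "'a \<Rightarrow>\<^sub>0 'k" assume "x \<in> supported_on M"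
  then have "lin_ext (\<lambda>a. Poly_Mapping.single a 1) x \<in> V"
    by (intro lin_ext_mem assms) (auto simp: supported_on_def)
  then show "x \<in> V" by (simp add: lin_ext_unit)
qed

lemma subspace_subalgebra:
  fixes A :: "('i, 'k::field) ck set"
  assumes "subalgebra A"
  shows "pm.subspace A"
proof (rule pm.subspaceI)
  \<comment> \<open>\<open>subalgebra\<close> does not mention zero, which arises by scaling the
    unit.\<close>
  have "pm_scale 0 1 \<in> A" using assms unfolding subalgebra_def by blast
  then show "0 \<in> A" by (simp only: pm.scale_zero_left)
qed (use assms in \<open>auto simp: subalgebra_def\<close>)

lemma tensor_single:
  "tensor (Poly_Mapping.single f 1) (Poly_Mapping.single g 1) = Poly_Mapping.single (f, g) 1"
  by (simp add: tensor_def lin_ext_single)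

text \<open>Each basis pair is a pure tensor of two elements of the subspace. This turns a bound on
  the support of a coproduct into membership in the tensor square.\<close>

lemma supported_on_tensor_square:
  "supported_on (M \<times> M) \<subseteq> tensor_square (supported_on M)"
proof (rule supported_on_subset_subspace)
  show "pm.subspace (tensor_square (supported_on M))"
    by (simp add: tensor_square_def pm.subspace_span)
  fix a :: "'a forest \<times> 'a forest" assume "a \<in> M \<times> M"
  then obtain f g where a: "a = (f, g)" "f \<in> M" "g \<in> M" by blast
  then show "Poly_Mapping.single a (1 :: 'b) \<in> tensor_square (supported_on M)"
    unfolding tensor_square_def a(1) tensor_single[symmetric]
    by (intro pm.span_base) (blast intro: supported_on_single)
qed


section \<open>Ladders\<close>

text \<open>Counting edges rather than vertices makes every ladder non-empty.\<close>

primrec ladder :: "('i \<Rightarrow> 'i) \<Rightarrow> nat \<Rightarrow> 'i \<Rightarrow> 'i dtree" where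
  "ladder s 0 i = Node i {#}"
| "ladder s (Suc n) i = Node i {#ladder s n (s i)#}"

primrec planar_ladder :: "('i \<Rightarrow> 'i) \<Rightarrow> nat \<Rightarrow> 'i \<Rightarrow> 'i ptree" where
  "planar_ladder s 0 i = PNode i []"
| "planar_ladder s (Suc n) i = PNode i [planar_ladder s n (s i)]"

lemma num_vertices_ladder: "num_vertices (ladder s n i) = Suc n"
  by (induction n arbitrary: i) auto

lemma decs_ladder:
  assumes "s ` I \<subseteq> I" "i \<in> I"
  shows "decs (ladder s n i) \<subseteq> I"
  using assms(2) by (induction n arbitrary: i) (use assms(1) in auto)

lemma funpow_closed: "s ` I \<subseteq> I \<Longrightarrow> i \<in> I \<Longrightarrow> (s ^^ k) i \<in> I"
  by (induction k) auto

text \<open>No vertex has two children to order, so the planar representative is unique. This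
  identifies the one that \<open>SOME\<close> picks in \<open>coproduct_tree\<close>.\<close>

lemma forget_planar_eq_ladder:
  "forget_planar p = ladder s n i \<Longrightarrow> p = planar_ladder s n i"
proof (induction n arbitrary: p i)
  case 0
  then show ?case by (cases p) auto
next
  case (Suc n)
  obtain j ts where p: "p = PNode j ts" by (cases p)
  have "mset (map forget_planar ts) = {#ladder s n (s i)#}"
    using Suc.prems p by simp
  then obtain q where "ts = [q]" "forget_planar q = ladder s n (s i)"
    by (auto simp only: mset_single_iff map_eq_Cons_conv map_is_Nil_conv)
  then show ?case using Suc p by simp
qed

text \<open>The only child index is 0, so a position is a word of zeros and is determined by its
  depth.\<close>

lemma subtree_at_planar_ladder:
  "subtree_at (planar_ladder s n i) p =
     (if \<exists>k\<le>n. p = replicate k 0 then Some (planar_ladder s (n - length p) ((s ^^ length p) i))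
      else None)"
proof (induction n arbitrary: p i)
  case 0
  then show ?case by (cases p) auto
next
  case (Suc n)
  show ?case
  proof (cases p)
    case Nil
    then show ?thesis by auto
  next
    case (Cons a q)
    have "(\<exists>k\<le>Suc n. p = replicate k 0) \<longleftrightarrow> a = 0 \<and> (\<exists>k\<le>n. q = replicate k 0)" (is "?l = ?r")
    proof
      assume ?l
      then obtain k where "k \<le> Suc n" "p = replicate k 0" by blast
      then show ?r using Cons by (cases k) auto
    next
      assume ?r
      then obtain k where "k \<le> n" "p = replicate (Suc k) 0" using Cons by auto
      then show ?l by (intro exI[of _ "Suc k"]) simp
    qed
    \<comment> \<open>Descent into the child applies \<open>s\<close> first, whereas unfolding
      \<open>funpow\<close> applies it last.\<close>
    moreover have "s ((s ^^ m) i) = (s ^^ m) (s i)" for m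
      by (rule funpow_swap1)
    ultimately show ?thesis
      unfolding Cons by (simp add: Suc)
  qed
qed

section \<open>Admissible cuts of a ladder and the pieces they leave\<close>

lemma positions_planar_ladder:
  "positions (planar_ladder s n i) = {replicate k 0 | k. k \<le> n}"
  by (auto simp: positions_def subtree_at_planar_ladder)

text \<open>All edges lie on the path to the unique leaf, so admissibility allows at most one edge,
  and a cut is non-empty.\<close>

lemma admissible_cut_planar_ladder:
  assumes "admissible_cut (planar_ladder s n i) c"
  obtains k where "1 \<le> k" "k \<le> n" "c = {replicate k 0}"
proof -
  let ?t = "planar_ladder s n i"
  \<comment> \<open>A position below depth \<open>n\<close> would be too long, so the word of
    \<open>n\<close> zeros is a leaf.\<close>
  have "replicate n 0 @ [a] \<noteq> replicate m 0" if "m \<le> n" for m and a :: nat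
  proof
    assume "replicate n 0 @ [a] = replicate m 0"
    then have "Suc n = m" by (metis length_append_singleton length_replicate)
    with that show False by simp
  qed
  then have leaf: "replicate n 0 \<in> leaves ?t"
    by (simp add: leaves_def positions_planar_ladder) (metis order_refl)
  have c: "c \<noteq> {}" "c \<subseteq> edges ?t"
    using assms by (auto simp: admissible_cut_def)
  have "prefix e (replicate n 0)" if e: "e \<in> c" for e
  proof -
    obtain k where k: "k \<le> n" "e = replicate k 0"
      using e c(2) by (auto simp: edges_def positions_planar_ladder)
    then have "replicate n 0 = e @ replicate (n - k) 0"
      using replicate_add[of k "n - k" "0::nat"] by simp
    then show ?thesis by (rule prefixI)
  qed
  then have "{e \<in> c. prefix e (replicate n 0)} = c" by auto
  moreover have "card {e \<in> c. prefix e (replicate n 0)} \<le> 1"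
    using assms leaf unfolding admissible_cut_def by blast
  ultimately have "card c \<le> 1" by simp
  moreover have "card c \<noteq> 0"
    using c finite_subset[OF c(2)] by (simp add: edges_def finite_positions)
  ultimately have "card c = 1" by linarith
  then obtain e where e: "c = {e}"
    by (rule card_1_singletonE)
  then obtain k where "k \<le> n" "e = replicate k 0" "e \<noteq> []"
    using c(2) by (auto simp: edges_def positions_planar_ladder)
  then show ?thesis using that[of k] e by (cases k) simp_all
qed

text \<open>The cut edge ends at depth \<open>k\<close> and the subladder starts at depth
  \<open>j\<close>. If the edge lies inside, the vertices at depths \<open>j\<close> to
  \<open>k - 1\<close> survive, hence \<open>k - j - 1\<close> edges. The case \<open>j = 0\<close>
  yields the root component and \<open>j = k\<close> the piece below the cut.\<close>

lemma component_planar_ladder: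
  "component {replicate k 0} (replicate j 0) (planar_ladder s n i) =
     ladder s (if j < k \<and> k \<le> j + n then k - j - 1 else n) i"
proof (induction n arbitrary: i j)
  case (Suc n)
  have "replicate j 0 @ [0] = replicate (Suc j) (0::nat)"
    by (simp add: replicate_append_same)
  moreover have "replicate (Suc j) (0::nat) \<in> {replicate k 0} \<longleftrightarrow> Suc j = k"
    by (metis length_replicate singleton_iff)
  ultimately have eq: "component {replicate k 0} (replicate j 0) (planar_ladder s (Suc n) i) =
      Node i (if Suc j = k then {#}
        else {#component {replicate k 0} (replicate (Suc j) 0) (planar_ladder s n (s i))#})"
    by (simp del: replicate_Suc singleton_iff)
  have "k - Suc j = Suc (k - Suc (Suc j))" if "Suc j < k"
    using that by simp
  then show ?case
    unfolding eq Suc by (cases "Suc j = k") auto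
qed simp

definition ladder_forests :: "'i set \<Rightarrow> ('i \<Rightarrow> 'i) \<Rightarrow> 'i forest set" where
  "ladder_forests I s = {f. \<forall>t\<in>#f. \<exists>i\<in>I. \<exists>n. t = ladder s n i}"

lemma ladder_forests_add:
  "f \<in> ladder_forests I s \<Longrightarrow> g \<in> ladder_forests I s \<Longrightarrow> f + g \<in> ladder_forests I s"
  by (auto simp: ladder_forests_def)

lemma ladder_forests_empty: "{#} \<in> ladder_forests I s"
  by (simp add: ladder_forests_def)

lemma ladder_forests_single: "i \<in> I \<Longrightarrow> {#ladder s n i#} \<in> ladder_forests I s"
  by (auto simp: ladder_forests_def)


section \<open>Stability of the span of ladder forests\<close>

lemma subalgebra_ladders: "subalgebra (supported_on (ladder_forests I s))"
  unfolding subalgebra_def single_one[symmetric]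
  by (intro conjI ballI allI supported_on_single ladder_forests_empty
      pm.subspace_add pm.subspace_scale supported_on_subspace)
     (auto intro: supported_on_mult ladder_forests_add)

text \<open>Only the left degree is bounded, because the recursion through \<open>S * id\<close>
  applies \<open>S\<close> to left factors.\<close>

definition lower_pairs :: "'i forest set \<Rightarrow> nat \<Rightarrow> ('i forest \<times> 'i forest) set" where
  "lower_pairs M n = {(g, h). g \<in> M \<and> h \<in> M \<and> forest_degree g < n}"

text \<open>The split isolates the only term whose left factor has full degree. The term with empty
  left factor and the proper cuts all go into \<open>r\<close>; a cut at depth \<open>k\<close>
  takes \<open>k\<close> vertices away from the left factor.\<close>

lemma coproduct_tree_ladder:
  assumes "s ` I \<subseteq> I" "i \<in> I"
  obtains r where
    "coproduct_tree (ladder s n i) = Poly_Mapping.single ({#ladder s n i#}, {#}) 1 + r"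
    "r \<in> supported_on (lower_pairs (ladder_forests I s) (num_vertices (ladder s n i)))"
proof -
  let ?t = "ladder s n i"
  let ?V = "supported_on (lower_pairs (ladder_forests I s) (num_vertices ?t))"
  define p where "p = (SOME p. forget_planar p = ?t)"
  have "forget_planar p = ?t"
    unfolding p_def by (rule someI_ex) (rule forget_planar_surj)
  then have p: "p = planar_ladder s n i"
    by (rule forget_planar_eq_ladder)
  have "Poly_Mapping.single (cut_P c p, {#cut_R c p#}) 1 \<in> ?V" if c: "admissible_cut p c" for c
  proof -
    obtain k where k: "1 \<le> k" "k \<le> n" "c = {replicate k 0}"
      using c p admissible_cut_planar_ladder by metis
    have P: "cut_P c p = {#ladder s (n - k) ((s ^^ k) i)#}"
      using k by (auto simp: cut_P_def p subtree_at_planar_ladder component_planar_ladder)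
    have R: "cut_R c p = ladder s (k - 1) i"
      using k component_planar_ladder[of k 0 s n i] by (simp add: cut_R_def p)
    show ?thesis
      unfolding P R
      by (rule supported_on_single)
         (use k assms in \<open>auto simp: lower_pairs_def forest_degree_def num_vertices_ladder
           intro: ladder_forests_single funpow_closed\<close>)
  qed
  then have "(\<Sum>c | admissible_cut p c. Poly_Mapping.single (cut_P c p, {#cut_R c p#}) 1) \<in> ?V"
    by (intro pm.subspace_sum supported_on_subspace) auto
  moreover have "Poly_Mapping.single ({#}, {#?t#}) 1 \<in> ?V"
    using assms by (auto simp: lower_pairs_def forest_degree_def num_vertices_ladder
        intro!: supported_on_single ladder_forests_empty ladder_forests_single)
  ultimately have "Poly_Mapping.single ({#}, {#?t#}) 1 +
      (\<Sum>c | admissible_cut p c. Poly_Mapping.single (cut_P c p, {#cut_R c p#}) 1) \<in> ?V"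
    by (intro pm.subspace_add supported_on_subspace)
  then show ?thesis
    by (rule that[rotated]) (simp add: coproduct_tree_def p_def Let_def add.assoc)
qed

text \<open>Left degrees add under multiplication. Multiplying out, the product of the leading terms
  is the new leading term, and each cross term has a factor of strictly smaller left degree.\<close>

lemma coproduct_ladder_forest:
  assumes "s ` I \<subseteq> I" "f \<in> ladder_forests I s"
  shows "\<exists>r :: ('i, 'k::field) ck2. (\<Prod>t\<in>#f. coproduct_tree t) = Poly_Mapping.single (f, {#}) 1 + r \<and>
             r \<in> supported_on (lower_pairs (ladder_forests I s) (forest_degree f))"
  using assms(2)
proof (induction f)
  case empty
  \<comment> \<open>The unit sits at the zero pair, which consists of two empty forests.\<close>
  have "(1 :: ('i, 'k) ck2) = Poly_Mapping.single ({#}, {#}) 1"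
    by (metis single_one zero_prod_def)
  then show ?case
    by (intro exI[of _ 0]) (simp add: pm.subspace_0[OF supported_on_subspace])
next
  case (add t f)
  let ?M = "ladder_forests I s"
  obtain i n where t: "t = ladder s n i" and i: "i \<in> I"
    using add.prems by (auto simp: ladder_forests_def)
  have f: "f \<in> ?M" and tM: "{#t#} \<in> ?M"
    using add.prems by (auto simp: ladder_forests_def)
  obtain r :: "('i, 'k) ck2" where r: "(\<Prod>t\<in>#f. coproduct_tree t) = Poly_Mapping.single (f, {#}) 1 + r"
    "r \<in> supported_on (lower_pairs ?M (forest_degree f))"
    using add.IH f by blast
  obtain q :: "('i, 'k) ck2" where q: "coproduct_tree t = Poly_Mapping.single ({#t#}, {#}) 1 + q"
    "q \<in> supported_on (lower_pairs ?M (num_vertices t))"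
    using coproduct_tree_ladder[OF assms(1) i, of n] unfolding t by metis
  have deg: "forest_degree (add_mset t f) = num_vertices t + forest_degree f"
    by (simp add: forest_degree_def)
  have deg_add: "forest_degree (g + h) = forest_degree g + forest_degree h" for g h :: "'i forest"
    by (simp add: forest_degree_def)
  let ?V = "supported_on (lower_pairs ?M (forest_degree (add_mset t f)))"
  let ?t = "Poly_Mapping.single ({#t#}, {#}) (1 :: 'k)"
  let ?f = "Poly_Mapping.single (f, {#}) (1 :: 'k)"
  have "?t * r \<in> ?V"
    by (rule supported_on_mult[OF supported_on_single[of _ "{({#t#}, {#})}"] r(2)])
       (use tM in \<open>auto simp: lower_pairs_def forest_degree_def plus_prod_def intro: ladder_forests_add[OF tM, simplified]\<close>)
  moreover have "q * ?f \<in> ?V"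
    by (rule supported_on_mult[OF q(2) supported_on_single[of _ "{(f, {#})}"]])
       (use f in \<open>auto simp: lower_pairs_def deg deg_add plus_prod_def
         intro: ladder_forests_add\<close>)
  moreover have "q * r \<in> ?V"
    by (rule supported_on_mult[OF q(2) r(2)])
       (auto simp: lower_pairs_def deg deg_add plus_prod_def intro: ladder_forests_add)
  ultimately have V: "?t * r + q * ?f + q * r \<in> ?V"
    by (intro pm.subspace_add supported_on_subspace)
  have "?t * ?f = Poly_Mapping.single (add_mset t f, {#}) 1"
    by (simp add: mult_single plus_prod_def)
  then have "(\<Prod>t\<in>#add_mset t f. coproduct_tree t) =
      Poly_Mapping.single (add_mset t f, {#}) 1 + (?t * r + q * ?f + q * r)"
    by (simp add: r(1) q(1) algebra_simps)
  then show ?case using V by blast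
qed

lemma coproduct_ladders:
  assumes "s ` I \<subseteq> I" "x \<in> supported_on (ladder_forests I s)"
  shows "coproduct x \<in> supported_on (ladder_forests I s \<times> ladder_forests I s)"
  unfolding coproduct_def
proof (intro lin_ext_mem supported_on_subspace)
  let ?M = "ladder_forests I s"
  fix f assume "f \<in> Poly_Mapping.keys x"
  then have f: "f \<in> ?M" using assms by (auto simp: supported_on_def)
  obtain r :: "('a, 'b) ck2"
    where r: "(\<Prod>t\<in>#f. coproduct_tree t) = Poly_Mapping.single (f, {#}) 1 + r"
      "r \<in> supported_on (lower_pairs ?M (forest_degree f))"
    using coproduct_ladder_forest[OF assms(1) f] by blast
  show "(\<Prod>t\<in>#f. coproduct_tree t :: ('a, 'b) ck2) \<in> supported_on (?M \<times> ?M)"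
    unfolding r(1)
    by (intro pm.subspace_add supported_on_subspace supported_on_single
          supported_on_mono[OF r(2)])
       (use f in \<open>auto simp: lower_pairs_def ladder_forests_empty\<close>)
qed

lemma ladder_forests_decs:
  assumes "s ` I \<subseteq> I" "f \<in> ladder_forests I s"
  shows "forest_decs f \<subseteq> I"
  unfolding forest_decs_def
proof (rule UN_least)
  fix t assume "t \<in># f"
  then obtain i n where "i \<in> I" "t = ladder s n i"
    using assms(2) by (auto simp: ladder_forests_def)
  then show "decs t \<subseteq> I" by (simp add: decs_ladder[OF assms(1)])
qed

lemma supported_on_ladders_CK:
  assumes "s ` I \<subseteq> I"
  shows "supported_on (ladder_forests I s) \<subseteq> CK I"
  using ladder_forests_decs[OF assms] by (auto simp: supported_on_def CK_def subset_iff)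

text \<open>
  The value of \<open>S * id\<close> at a forest \<open>f\<close> is a constant; its summand for \<open>f \<otimes> 1\<close> is \<open>S(f)\<close>, and all the
  others involve \<open>S\<close> in lower degree only.
\<close>

lemma antipode_ladder_forest:
  fixes S :: "('i, 'k::field) ck \<Rightarrow> ('i, 'k) ck"
  assumes "s ` I \<subseteq> I" "is_antipode I S" "f \<in> ladder_forests I s"
  shows "S (Poly_Mapping.single f 1) \<in> supported_on (ladder_forests I s)"
  using assms(3)
proof (induction "forest_degree f" arbitrary: f rule: less_induct)
  \<comment> \<open>The empty forest is covered as well: no degree lies below 0, so then
    \<open>r\<close> has empty support.\<close>
  case less
  let ?M = "ladder_forests I s"
  let ?A = "supported_on ?M :: ('i, 'k) ck set"
  let ?\<phi> = "\<lambda>(f, g). S (Poly_Mapping.single f 1) * id (Poly_Mapping.single g 1)"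
  let ?x = "Poly_Mapping.single f 1 :: ('i, 'k) ck"
  obtain r :: "('i, 'k) ck2"
    where r: "(\<Prod>t\<in>#f. coproduct_tree t) = Poly_Mapping.single (f, {#}) 1 + r"
      "r \<in> supported_on (lower_pairs ?M (forest_degree f))"
    using coproduct_ladder_forest[OF assms(1) less.prems] by blast
  have "?x \<in> CK I"
    using supported_on_ladders_CK[OF assms(1)] supported_on_single[OF less.prems] by blast
  then have "convolution S id ?x = pm_scale (counit ?x) 1"
    using assms(2) by (auto simp: is_antipode_def)
  moreover have "convolution S id ?x = S ?x + lin_ext ?\<phi> r"
    unfolding convolution_def coproduct_def lin_ext_single r(1) lin_ext_add
    by simp
  ultimately have "S ?x = pm_scale (counit ?x) 1 - lin_ext ?\<phi> r"
    by (simp add: eq_diff_eq)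
  moreover have "lin_ext ?\<phi> r \<in> ?A"
  proof (intro lin_ext_mem supported_on_subspace)
    fix a assume "a \<in> Poly_Mapping.keys r"
    then obtain g h where a: "a = (g, h)" "g \<in> ?M" "h \<in> ?M" "forest_degree g < forest_degree f"
      using r(2) by (auto simp: supported_on_def lower_pairs_def)
    then show "?\<phi> a \<in> ?A"
      using less.hyps[of g] subalgebra_ladders supported_on_single[of h ?M 1]
      by (auto simp: subalgebra_def)
  qed
  moreover have "pm_scale (counit ?x) 1 \<in> ?A"
    using subalgebra_ladders unfolding subalgebra_def by blast
  ultimately show ?case
    by (simp add: pm.subspace_diff supported_on_subspace)
qed

lemma Hopf_subalgebra_ladders:
  assumes "s ` I \<subseteq> I"
  shows "Hopf_subalgebra I (supported_on (ladder_forests I s) :: ('i, 'k::field) ck set)"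
  unfolding Hopf_subalgebra_def
proof (intro conjI ballI allI impI)
  let ?A = "supported_on (ladder_forests I s) :: ('i, 'k) ck set"
  show "coproduct x \<in> tensor_square ?A" if "x \<in> ?A" for x
    using coproduct_ladders[OF assms that] supported_on_tensor_square by blast
  show "S ` ?A \<subseteq> ?A" if S: "is_antipode I S" for S
  proof -
    have lin: "Vector_Spaces.linear pm_scale pm_scale S"
      using S by (simp add: is_antipode_def)
    interpret S: Vector_Spaces.linear pm_scale pm_scale S by (fact lin)
    \<comment> \<open>The preimage of a subspace under the linear map \<open>S\<close> is a
      subspace, so basis forests suffice.\<close>
    have "?A \<subseteq> S -` ?A"
      by (intro supported_on_subset_subspace S.subspace_vimage supported_on_subspace)
         (simp add: antipode_ladder_forest[OF assms S])
    then show ?thesis by blast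
  qed
qed (use supported_on_ladders_CK[OF assms] subalgebra_ladders in auto)

text \<open>Products of single ladders give all ladder forests, and these span. \<open>G\<close> may
  contain further elements of the span, such as the zero component in degree 0.\<close>

lemma hull_ladders:
  assumes "G \<subseteq> supported_on (ladder_forests I s)"
    and "\<And>i n. i \<in> I \<Longrightarrow> Poly_Mapping.single {#ladder s n i#} 1 \<in> G"
  shows "subalgebra hull G = supported_on (ladder_forests I s)"
proof (rule hull_unique)
  fix A assume A: "G \<subseteq> A" "subalgebra A"
  have "Poly_Mapping.single f 1 \<in> A" if "f \<in> ladder_forests I s" for f
    using that
  proof (induction f)
    case empty
    then show ?case using A(2) by (simp add: subalgebra_def)
  next
    case (add t f)
    then obtain i n where "i \<in> I" "t = ladder s n i"
      by (auto simp: ladder_forests_def)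
    then have t: "Poly_Mapping.single {#t#} 1 \<in> A"
      using assms(2) A(1) by blast
    have f: "Poly_Mapping.single f 1 \<in> A"
      using add by (simp add: ladder_forests_def)
    have "Poly_Mapping.single {#t#} 1 * Poly_Mapping.single f 1 \<in> A"
      using f t A(2) by (simp add: subalgebra_def)
    then show ?case by (simp add: mult_single)
  qed
  then show "supported_on (ladder_forests I s) \<subseteq> A"
    by (rule supported_on_subset_subspace[OF subspace_subalgebra[OF A(2)]])
qed (use assms(1) subalgebra_ladders in auto)


section \<open>Systems with series of the form \<open>1 + h_j\<close>\<close>

lemma mps_subst_one_plus_hvar:
  assumes "finite I" "j \<in> I" "fps_nth (X j) 0 = 0"
  shows "fps_nth (mps_subst I (Poly_Mapping.lookup (1 + hvar j)) X) n =
         (if n = 0 then 1 else 0) + fps_nth (X j) n"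
proof -
  let ?M = "{m. set_mset m \<subseteq> I \<and> size m \<le> n}"
  let ?g = "\<lambda>m. pm_scale (Poly_Mapping.lookup (1 + hvar j) m) (fps_nth (\<Prod>j\<in>#m. X j) n)"
  have g0: "?g m = 0" if "m \<noteq> {#}" "m \<noteq> {#j#}" for m
    using that by (simp add: lookup_add hvar_def lookup_one lookup_single when_def)
  have "sum ?g ?M = sum ?g (?M \<inter> {{#}, {#j#}})"
    by (rule sum.mono_neutral_right) (use g0 finite_monomials[OF assms(1)] in auto)
  also have "\<dots> = (if n = 0 then 1 else 0) + fps_nth (X j) n"
  proof (cases "n = 0")
    \<comment> \<open>In degree 0 the size bound excludes \<open>{#j#}\<close>; the vanishing
      constant term of \<open>X j\<close> makes the formula hold nevertheless.\<close>
    case True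
    then have "?M \<inter> {{#}, {#j#}} = {{#}}" by auto
    then show ?thesis
      using True assms(3) by (simp add: lookup_add hvar_def lookup_one lookup_single)
  next
    case False
    then have "?M \<inter> {{#}, {#j#}} = {{#}, {#j#}}" using assms(2) by auto
    then show ?thesis
      using False by (simp add: lookup_add hvar_def lookup_one lookup_single)
  qed
  finally show ?thesis by (simp add: mps_subst_def)
qed

lemma Bplus_single: "Bplus i (Poly_Mapping.single f 1) = Poly_Mapping.single {#Node i f#} 1"
  by (simp add: Bplus_def lin_ext_single)

text \<open>The equation becomes a recursion: the component of degree \<open>k + 1\<close> at
  \<open>i\<close> grafts the one of degree \<open>k\<close> at \<open>s i\<close> onto a root
  \<open>i\<close>. The constant 1 of the series matters only for \<open>k = 0\<close>, where it
  creates the single vertex.\<close>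

lemma solution_ladder:
  fixes F :: "'i \<Rightarrow> ('i, 'k::field) mps"
  assumes "finite I" "s ` I \<subseteq> I"
    and F: "\<And>i. i \<in> I \<Longrightarrow> F i = Poly_Mapping.lookup (1 + hvar (s i))"
    and "i \<in> I"
  shows "fps_nth (SDSE_solution I F i) n =
    (case n of 0 \<Rightarrow> 0 | Suc k \<Rightarrow> Poly_Mapping.single {#ladder s k i#} 1)"
proof -
  define X where "X = SDSE_solution I F"
  have "is_SDSE_solution I F X"
    unfolding X_def SDSE_solution_def by (rule theI'[OF SDSE_solution_ex1])
  then have X: "X i = Bplus_hat i (mps_subst I (F i) X)" if "i \<in> I" for i
    using that by (auto simp: is_SDSE_solution_def)
  have X0: "fps_nth (X i) 0 = 0" if "i \<in> I" for i
    by (subst X[OF that]) (simp add: Bplus_hat_nth)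
  have XS: "fps_nth (X i) (Suc k) =
      Bplus i ((if k = 0 then 1 else 0) + fps_nth (X (s i)) k)" if "i \<in> I" for i k
  proof -
    have s: "s i \<in> I" using that assms(2) by blast
    show ?thesis
      by (subst X[OF that])
         (simp add: Bplus_hat_nth F[OF that] mps_subst_one_plus_hvar assms(1) s X0)
  qed
  have "fps_nth (X i) (Suc k) = Poly_Mapping.single {#ladder s k i#} 1" if "i \<in> I" for i k
    using that
  proof (induction k arbitrary: i)
    case 0
    then have "s i \<in> I" using assms(2) by blast
    then show ?case
      \<comment> \<open>The unit is the basis element of the empty forest, so
        \<open>Bplus_single\<close> applies once simplified to that form.\<close>
      by (simp add: XS[OF 0] X0 Bplus_single[of i "{#}", simplified])
  next
    case (Suc k)
    then have "s i \<in> I" using assms(2) by blast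
    then show ?case
      using Suc.IH[of "s i"] by (simp add: XS[OF Suc.prems, of "Suc k"] Bplus_single)
  qed
  then show ?thesis
    using X0 assms(4) by (simp add: X_def split: nat.split)
qed

text \<open>The argument works for any self-map \<open>s\<close> of \<open>I\<close>; a cycle is one
  instance.\<close>

lemma Hopf_SDSE_one_plus_hvar:
  fixes F :: "'i \<Rightarrow> ('i, 'k::field) mps"
  assumes "finite I" "I \<noteq> {}" "s ` I \<subseteq> I"
    and F: "\<And>i. i \<in> I \<Longrightarrow> F i = Poly_Mapping.lookup (1 + hvar (s i))"
  shows "Hopf_SDSE I F"
proof -
  have s: "s i \<in> I" if "i \<in> I" for i
    using that assms(3) by blast
  have "SDSE I F"
    unfolding SDSE_def
  proof (intro conjI ballI allI impI assms)
    fix i assume i: "i \<in> I"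
    show "set_mset m \<subseteq> I" if "F i m \<noteq> 0" for m
      using that s[OF i] by (auto simp: F[OF i] lookup_add hvar_def lookup_one lookup_single
          when_def split: if_splits)
    show "\<exists>m. m \<noteq> {#} \<and> F i m \<noteq> 0"
      by (rule exI[of _ "{#s i#}"])
         (simp add: F[OF i] lookup_add hvar_def lookup_one lookup_single)
  qed
  moreover have "SDSE_subalgebra I F = supported_on (ladder_forests I s)"
    unfolding SDSE_subalgebra_def
  proof (rule hull_ladders)
    note sol = solution_ladder[OF assms(1,3) F]
    show "{fps_nth (SDSE_solution I F i) n | i n. i \<in> I} \<subseteq> supported_on (ladder_forests I s)"
      by (auto simp: sol pm.subspace_0[OF supported_on_subspace]
          intro!: supported_on_single ladder_forests_single split: nat.split)
    show "Poly_Mapping.single {#ladder s n i#} 1 \<in>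
        {fps_nth (SDSE_solution I F i) n | i n. i \<in> I}" if "i \<in> I" for i n
      \<comment> \<open>A ladder with \<open>n\<close> edges has \<open>n + 1\<close> vertices,
        hence the degree \<open>Suc n\<close>.\<close>
      using that sol[OF _ that, of "Suc n"] by (force intro: exI[of _ "Suc n"])
  qed
  ultimately show ?thesis
    by (simp add: Hopf_SDSE_def Hopf_subalgebra_ladders[OF assms(3)])
qed

theorem theorem30:
  fixes N :: nat and F :: "nat \<Rightarrow> (nat, 'k::field_char_0) mps"
  assumes "N \<ge> 2"
    and "\<And>i. 1 \<le> i \<Longrightarrow> i < N \<Longrightarrow> F i = Poly_Mapping.lookup (1 + hvar (i + 1))"
    and "F N = Poly_Mapping.lookup (1 + hvar 1)"
  shows "Hopf_SDSE {1..N} F"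
\<comment> \<open>The self-map is the cyclic successor, with \<open>N\<close> wrapping round to
  1.\<close>
proof (rule Hopf_SDSE_one_plus_hvar[where s = "\<lambda>i. if i < N then i + 1 else 1"])
  show "F i = Poly_Mapping.lookup (1 + hvar (if i < N then i + 1 else 1))" if "i \<in> {1..N}" for i
    using that assms(2)[of i] assms(3) by (cases "i < N") auto
qed (use assms(1) in auto)

end
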